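(* Let $\widetilde{\mathcal A}$ and $\widetilde{\mathcal B}$ be unlabeled combinatorial classes with $\widetilde{\mathcal A}=\mathrm{SEQ}(\widetilde{\mathcal B})$, and assume $\widetilde{\mathcal A}$ is gargantuan. Let $a\in\widetilde{\mathcal A}$ be a uniformly random object of size $n$. Then for every positive integer $m$, \[ \mathbb P(a\text{ has }m\ \mathrm{SEQ}\text{-irreducible components})\approx\sum_{k\ge0} m\Big(\widetilde{\mathfrak b}_k^{(m-1)}-2\widetilde{\mathfrak b}_k^{(m)}+\widetilde{\mathfrak b}_k^{(m+1)}\Big)\frac{\widetilde{\mathfrak a}_{n-k}}{\widetilde{\mathfrak a}_n}. \] In particular, for $m=1$, \[ \mathbb P(a\text{ is }\mathrm{SEQ}\text{-irreducible})\approx1-\sum_{k\ge1}\Big(2\widetilde{\mathfrak b}_k-\widetilde{\mathfrak b}_k^{(2)}\Big)\frac{\widetilde{\mathfrak a}_{n-k}}{\widetilde{\mathfrak a}_n}. \]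
   Context: An unlabeled combinatorial class is a collection of objects with finite sizes, with finitely many objects $\widetilde{\mathfrak a}_n$ of each size $n$; its ordinary generating function is $\widetilde A(z)=\sum_n\widetilde{\mathfrak a}_nz^n$. For an unlabeled class $\widetilde{\mathcal B}$ with $\widetilde{\mathfrak b}_0=0$, $\widetilde{\mathcal B}^m$ is the Cartesian product of $m$ copies (ordered $m$-tuples, size additive), and $\mathrm{SEQ}(\widetilde{\mathcal B})=\sum_{m\ge0}\widetilde{\mathcal B}^m$, with OGF $1/(1-\widetilde B(z))$. If $\widetilde{\mathcal A}=\mathrm{SEQ}(\widetilde{\mathcal B})$, an object lying in $\widetilde{\mathcal B}^m$ has $m$ $\mathrm{SEQ}$-irreducible components ($m=1$: $\mathrm{SEQ}$-irreducible). $\widetilde{\mathfrak b}_n^{(m)}$ is the number of objects of size $n$ in $\widetilde{\mathcal B}^m$, with convention $\widetilde{\mathfrak b}_0^{(0)}=1$, $\widetilde{\mathfrak b}_n^{(0)}=0$ for $n>0$. Random objects of size $n$ are uniform among the $\widetilde{\mathfrak a}_n$ objects of size $n$. A sequence $(a_n)$ is gargantuan if $a_{n-1}/a_n\to0$ and, for every positive integer $r$, $\sum_{k=r}^{n-r}|a_ka_{n-k}|=O(a_{n-r})$; an unlabeled class is gargantuan if its counting sequence $(\widetilde{\mathfrak a}_n)$ is gargantuan. Notation: $x_n\approx\sum_{k\ge m}c_kf_k(n)$ means that for every $r\ge m$, $x_n=\sum_{k=m}^r c_kf_k(n)+O(f_{r+1}(n))$, and $f_{k+1}(n)=o(f_k(n))$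 for every $k\ge m$ (the $c_k$ may be zero). *)

theory Defs
  imports "HOL-Probability.Probability" "HOL-Library.Landau_Symbols"
begin

record 'a comb_class =
  objects :: "'a set"
  obj_size :: "'a \<Rightarrow> nat"

definition of_size :: "'a comb_class \<Rightarrow> nat \<Rightarrow> 'a set" where
  "of_size C n = {x \<in> objects C. obj_size C x = n}"

definition unlabeled_class :: "'a comb_class \<Rightarrow> bool" where
  "unlabeled_class C \<longleftrightarrow> (\<forall>n. finite (of_size C n))"

definition counting :: "'a comb_class \<Rightarrow> nat \<Rightarrow> real" where
  "counting C n = real (card (of_size C n))"

text \<open>Ordered \<open>m\<close>-tuples are lists of length \<open>m\<close>. The power \<open>m = 0\<close> contains only the
  empty list, of size 0, so its counting sequence is 1, 0, 0, and so on.\<close>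

definition class_power :: "'a comb_class \<Rightarrow> nat \<Rightarrow> 'a list comb_class" where
  "class_power B m =
     \<lparr>objects = {xs. length xs = m \<and> set xs \<subseteq> objects B},
      obj_size = (\<lambda>xs. sum_list (map (obj_size B) xs))\<rparr>"

text \<open>The powers are pairwise disjoint (lists of different lengths), so the union is the
  sum of classes.\<close>

definition SEQ :: "'a comb_class \<Rightarrow> 'a list comb_class" where
  "SEQ B =
     \<lparr>objects = (\<Union>m. objects (class_power B m)),
      obj_size = (\<lambda>xs. sum_list (map (obj_size B) xs))\<rparr>"

definition has_SEQ_components :: "'a comb_class \<Rightarrow> nat \<Rightarrow> 'a list \<Rightarrow> bool" where
  "has_SEQ_components B m a \<longleftrightarrow> a \<in> objects (class_power B m)"

definition SEQ_irreducible :: "'a comb_class \<Rightarrow> 'a list \<Rightarrow> bool" where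
  "SEQ_irreducible B a \<longleftrightarrow> has_SEQ_components B 1 a"

text \<open>For the finitely many \<open>n\<close> at which \<open>of_size C n\<close> may be empty (in the gargantuan
  case) the value is unspecified; asymptotic statements do not depend on it.\<close>

definition uniform_prob :: "'a comb_class \<Rightarrow> nat \<Rightarrow> ('a \<Rightarrow> bool) \<Rightarrow> real" where
  "uniform_prob C n P = measure_pmf.prob (pmf_of_set (of_size C n)) {x. P x}"

text \<open>The quotient \<open>a (n - 1) / a n\<close> is only meaningful if \<open>a n\<close> is eventually nonzero.
  Since \<open>x / 0 = 0\<close> in HOL, this has to be required explicitly.\<close>

definition gargantuan :: "(nat \<Rightarrow> real) \<Rightarrow> bool" where
  "gargantuan a \<longleftrightarrow>
     (\<forall>\<^sub>F n in sequentially. a n \<noteq> 0) \<and>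
     (\<lambda>n. a (n - 1) / a n) \<longlonglongrightarrow> 0 \<and>
     (\<forall>r\<ge>1. (\<lambda>n. \<Sum>k=r..n-r. \<bar>a k * a (n - k)\<bar>) \<in> O(\<lambda>n. a (n - r)))"

definition gargantuan_class :: "'a comb_class \<Rightarrow> bool" where
  "gargantuan_class C \<longleftrightarrow> gargantuan (counting C)"

text \<open>\<open>asymp_expansion x m c f\<close> reads \<open>x n \<approx> (\<Sum>k\<ge>m. c k * f k n)\<close>; no convergence of the
  series is involved.\<close>

definition asymp_expansion ::
  "(nat \<Rightarrow> real) \<Rightarrow> nat \<Rightarrow> (nat \<Rightarrow> real) \<Rightarrow> (nat \<Rightarrow> nat \<Rightarrow> real) \<Rightarrow> bool" where
  "asymp_expansion x m c f \<longleftrightarrow>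
     (\<forall>r\<ge>m. (\<lambda>n. x n - (\<Sum>k=m..r. c k * f k n)) \<in> O(f (r + 1))) \<and>
     (\<forall>k\<ge>m. f (k + 1) \<in> o(f k))"

end

theory Submission
  imports Defs "HOL-Computational_Algebra.Formal_Power_Series"
begin

text \<open>A series \<open>F\<close> whose coefficients are dominated by a gargantuan sequence \<open>a\<close> may have an expansion
  \<open>F\<^sub>n \<approx> (\<Sum>k\<ge>0. G\<^sub>k a\<^sub>n\<^sub>-\<^sub>k)\<close>; write \<open>F \<mapsto> G\<close>. Only the two ends of a convolution
  matter asymptotically, so \<open>F \<mapsto> G\<close> behaves as a derivation with \<open>A \<mapsto> 1\<close>, where \<open>A = \<Sum>n. a\<^sub>n z\<^sup>n\<close>.
  From \<open>A (1 - B) = 1\<close> one gets \<open>B \<mapsto> (1 - B)\<^sup>2\<close>, hence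
  \<open>B\<^sup>m \<mapsto> m B\<^sup>m\<^sup>-\<^sup>1 (1 - B)\<^sup>2 = m (B\<^sup>m\<^sup>-\<^sup>1 - 2 B\<^sup>m + B\<^sup>m\<^sup>+\<^sup>1)\<close>.\<close>

unbundle no vec_syntax
unbundle fps_syntax

section \<open>Expansions along a gargantuan sequence\<close>

text \<open>The order \<open>r\<close> is a parameter because the expansion of \<open>B\<close> is
  found by induction on it. \<open>G\<close> is a power series, so that the rules for coefficients
  become identities between series. Truncated subtraction affects only finitely many
  \<open>n\<close>.\<close>

definition expansion_upto :: "(nat \<Rightarrow> real) \<Rightarrow> real fps \<Rightarrow> real fps \<Rightarrow> nat \<Rightarrow> bool" where
  "expansion_upto a F G r \<longleftrightarrow>
     (\<lambda>n. F $ n - (\<Sum>k\<le>r. G $ k * a (n - k))) \<in> O(\<lambda>n. a (n - Suc r))"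

lemma bigo_shift:
  fixes f g :: "nat \<Rightarrow> real"
  assumes "f \<in> O(g)"
  shows "(\<lambda>n. f (n - k)) \<in> O(\<lambda>n. g (n - k))"
  using assms filterlim_minus_const_nat_at_top by (rule landau_o.big.compose)

lemma gargantuan_smallo_shift:
  assumes "gargantuan a"
  shows "(\<lambda>n. a (n - Suc k)) \<in> o(\<lambda>n. a (n - k))"
proof -
  have "(\<lambda>n. a (n - 1)) \<in> o(a)"
    using assms by (intro smalloI_tendsto) (auto simp: gargantuan_def)
  from landau_o.small.compose[OF this filterlim_minus_const_nat_at_top[of k]] show ?thesis
    by simp
qed

text \<open>What remains after removing both ends is the middle of the convolution. Domination
  bounds it termwise by the sum in the definition of \<open>gargantuan\<close>, taken with parameter
  \<open>Suc r\<close>.\<close>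

lemma gargantuan_convolution_ends:
  fixes f h :: "nat \<Rightarrow> real"
  assumes a: "gargantuan a" and f: "\<And>k. \<bar>f k\<bar> \<le> \<bar>a k\<bar>" and h: "\<And>k. \<bar>h k\<bar> \<le> \<bar>a k\<bar>"
  shows "(\<lambda>n. (\<Sum>k\<le>n. f k * h (n - k)) - (\<Sum>k\<le>r. f k * h (n - k)) - (\<Sum>k\<le>r. h k * f (n - k)))
           \<in> O(\<lambda>n. a (n - Suc r))"
    (is "?e \<in> _")
proof -
  let ?mid = "\<lambda>n. \<Sum>k=Suc r..n - Suc r. \<bar>a k * a (n - k)\<bar>"
  \<comment> \<open>For such \<open>n\<close> the two ends do not overlap.\<close>
  have "norm (?e n) \<le> norm (?mid n)" if n: "n \<ge> 2 * r + 2" for n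
  proof -
    let ?g = "\<lambda>k. f k * h (n - k)"
    have split: "{..n} = ({..r} \<union> {Suc r..n - Suc r}) \<union> {n - r..n}"
      using n by auto
    have "sum ?g {..n} = sum ?g {..r} + sum ?g {Suc r..n - Suc r} + sum ?g {n - r..n}"
      unfolding split using n by (subst sum.union_disjoint; (subst sum.union_disjoint)?; force)
    moreover have "sum ?g {n - r..n} = (\<Sum>k\<le>r. h k * f (n - k))"
      using n by (intro sum.reindex_bij_witness[of _ "\<lambda>k. n - k" "\<lambda>k. n - k"]) auto
    ultimately have "?e n = sum ?g {Suc r..n - Suc r}" by simp
    also have "\<bar>\<dots>\<bar> \<le> (\<Sum>k=Suc r..n - Suc r. \<bar>?g k\<bar>)" by (rule sum_abs)
    also have "\<dots> \<le> ?mid n"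
      by (intro sum_mono) (auto simp: abs_mult intro!: mult_mono f h)
    finally show ?thesis by simp
  qed
  then have "?e \<in> O(?mid)"
    by (intro landau_o.big_mono eventually_sequentiallyI) auto
  moreover have "?mid \<in> O(\<lambda>n. a (n - Suc r))"
    using a unfolding gargantuan_def by auto
  ultimately show ?thesis by (rule landau_o.big_trans)
qed

text \<open>Each \<open>H $ (n - k)\<close> is expanded only to order \<open>r - k\<close>: its
  error, shifted by \<open>k\<close>, is already O of \<open>a (n - Suc r)\<close>. Collecting the
  terms with \<open>k + j = s\<close> yields the Cauchy product \<open>F * K\<close>. Indices with
  \<open>F $ k = 0\<close> are exempt, so that a factor with vanishing constant term calls only for
  orders below \<open>r\<close>.\<close>

lemma expansion_convolution_end:
  assumes exp: "\<And>k. k \<le> r \<Longrightarrow> F $ k \<noteq> 0 \<Longrightarrow> expansion_upto a H K (r - k)"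
  shows "(\<lambda>n. (\<Sum>k\<le>r. F $ k * H $ (n - k)) - (\<Sum>s\<le>r. (F * K) $ s * a (n - s)))
           \<in> O(\<lambda>n. a (n - Suc r))"
proof -
  have "(\<lambda>n. (\<Sum>k\<le>r. F $ k * H $ (n - k)) - (\<Sum>s\<le>r. (F * K) $ s * a (n - s))) =
        (\<lambda>n. \<Sum>k\<le>r. F $ k * (H $ (n - k) - (\<Sum>j\<le>r - k. K $ j * a (n - k - j))))"
  proof
    fix n
    have "(\<Sum>s\<le>r. (F * K) $ s * a (n - s)) =
          (\<Sum>s\<le>r. \<Sum>k\<le>s. F $ k * K $ (s - k) * a (n - (k + (s - k))))"
      by (simp add: fps_mult_nth atLeast0AtMost sum_distrib_right)
    also have "\<dots> = (\<Sum>k\<le>r. \<Sum>j\<le>r - k. F $ k * K $ j * a (n - (k + j)))"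
      by (subst sum.Sigma, simp, simp, subst sum.Sigma, simp, simp,
          intro sum.reindex_bij_witness[of _ "\<lambda>(k, j). (k + j, k)" "\<lambda>(s, k). (k, s - k)"]) auto
    finally show "(\<Sum>k\<le>r. F $ k * H $ (n - k)) - (\<Sum>s\<le>r. (F * K) $ s * a (n - s)) =
        (\<Sum>k\<le>r. F $ k * (H $ (n - k) - (\<Sum>j\<le>r - k. K $ j * a (n - k - j))))"
      by (simp add: right_diff_distrib sum_subtractf sum_distrib_left mult.assoc)
  qed
  also have "\<dots> \<in> O(\<lambda>n. a (n - Suc r))"
  proof (intro big_sum_in_bigo)
    fix k assume "k \<in> {..r}"
    then have k: "k \<le> r" by simp
    show "(\<lambda>n. F $ k * (H $ (n - k) - (\<Sum>j\<le>r - k. K $ j * a (n - k - j)))) \<in> O(\<lambda>n. a (n - Suc r))"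
    proof (cases "F $ k = 0")
      case False
      from bigo_shift[OF exp[OF k False, unfolded expansion_upto_def], of k] k
      show ?thesis by (simp add: False)
    qed simp
  qed
  finally show ?thesis .
qed

text \<open>The Leibniz rule: at one end of the convolution \<open>H\<close> is expanded, at the
  other \<open>F\<close>, and the two contributions add.\<close>

lemma expansion_mult:
  assumes "gargantuan a" "\<And>k. \<bar>F $ k\<bar> \<le> \<bar>a k\<bar>" "\<And>k. \<bar>H $ k\<bar> \<le> \<bar>a k\<bar>"
    and F: "\<And>r. expansion_upto a F G r" and H: "\<And>r. expansion_upto a H K r"
  shows "expansion_upto a (F * H) (F * K + H * G) r"
  unfolding expansion_upto_def
  using sum_in_bigo(1)[OF gargantuan_convolution_ends[OF assms(1-3), of r]
      sum_in_bigo(1)[OF expansion_convolution_end[of r F a H K, OF H]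
        expansion_convolution_end[of r H a F G, OF F]]]
  by (simp add: fps_mult_nth atLeast0AtMost algebra_simps sum.distrib)

text \<open>The Leibniz rule cannot be applied to \<open>A * (1 - B) = 1\<close>, since it
  presupposes an expansion of \<open>B\<close>. Instead, both ends of \<open>B * A = A - 1\<close>
  are compared. As \<open>A $ 0 = 1\<close>, the term \<open>B $ n\<close> can be isolated, and the
  other values of \<open>B\<close> near \<open>n\<close> occur as \<open>B $ (n - k)\<close> with
  \<open>k \<ge> 1\<close>, where lower orders suffice.\<close>

lemma expansion_of_inverse:
  assumes a: "gargantuan a" and inv: "Abs_fps a * (1 - B) = 1" and B0: "B $ 0 = 0"
    and B: "\<And>k. \<bar>B $ k\<bar> \<le> \<bar>a k\<bar>"
  shows "expansion_upto a B ((1 - B)\<^sup>2) r"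
proof (induction r rule: less_induct)
  case (less r)
  define A where "A = Abs_fps a"
  have A_nth: "A $ n = a n" for n by (simp add: A_def)
  have AB: "A * (1 - B) = 1" using inv by (simp add: A_def)
  have A0: "A $ 0 = 1" using arg_cong[OF AB, of "\<lambda>F. F $ 0"] B0 by simp
  have BA: "B * A = A - 1" using AB by (simp add: algebra_simps)
  \<comment> \<open>Isolating \<open>B $ n\<close> gives the coefficient series
    \<open>1 - B - (A - 1) * (1 - B)\<^sup>2\<close>; this identity reduces it to
    \<open>(1 - B)\<^sup>2\<close>.\<close>
  have AG: "(A - 1) * (1 - B)\<^sup>2 = 1 - B - (1 - B)\<^sup>2"
  proof -
    have "(A - 1) * (1 - B)\<^sup>2 = A * (1 - B) * (1 - B) - (1 - B)\<^sup>2"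
      by (simp only: power2_eq_square left_diff_distrib mult.assoc mult_1)
    then show ?thesis by (simp add: AB)
  qed
  have ends: "(\<lambda>n. (B * A) $ n - (\<Sum>k\<le>r. B $ k * a (n - k)) - (\<Sum>k\<le>r. A $ k * B $ (n - k)))
      \<in> O(\<lambda>n. a (n - Suc r))"
    using gargantuan_convolution_ends[OF a B, of a r]
    by (simp add: fps_mult_nth atLeast0AtMost A_nth)
  \<comment> \<open>The constant term of \<open>A - 1\<close> is zero, so \<open>k > 0\<close> and
    the induction hypothesis applies to \<open>r - k < r\<close>.\<close>
  have "expansion_upto a B ((1 - B)\<^sup>2) (r - k)" if "k \<le> r" "(A - 1) $ k \<noteq> 0" for k
    using that A0 by (intro less.IH) (cases k; auto)
  then have "(\<lambda>n. (\<Sum>k\<le>r. (A - 1) $ k * B $ (n - k)) -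
      (\<Sum>s\<le>r. ((A - 1) * (1 - B)\<^sup>2) $ s * a (n - s))) \<in> O(\<lambda>n. a (n - Suc r))"
    by (rule expansion_convolution_end)
  then have low: "(\<lambda>n. (\<Sum>k\<le>r. (A - 1) $ k * B $ (n - k)) -
      (\<Sum>s\<le>r. (1 - B - (1 - B)\<^sup>2) $ s * a (n - s))) \<in> O(\<lambda>n. a (n - Suc r))"
    unfolding AG .
  have one: "(\<Sum>k\<le>r. (if k = 0 then 1 else 0) * g k) = g 0" for g :: "nat \<Rightarrow> real"
    by (subst sum.remove[of _ 0]) auto
  \<comment> \<open>For \<open>n > 0\<close> the constant 1 in \<open>B * A = A - 1\<close> does not
    contribute.\<close>
  have "\<forall>\<^sub>F n in sequentially. B $ n - (\<Sum>k\<le>r. ((1 - B)\<^sup>2) $ k * a (n - k)) =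
      - ((B * A) $ n - (\<Sum>k\<le>r. B $ k * a (n - k)) - (\<Sum>k\<le>r. A $ k * B $ (n - k)))
      - ((\<Sum>k\<le>r. (A - 1) $ k * B $ (n - k)) - (\<Sum>s\<le>r. (1 - B - (1 - B)\<^sup>2) $ s * a (n - s)))"
    using eventually_gt_at_top[of 0]
    by eventually_elim (simp add: BA A_nth left_diff_distrib sum_subtractf one)
  moreover have "(\<lambda>n. - ((B * A) $ n - (\<Sum>k\<le>r. B $ k * a (n - k)) - (\<Sum>k\<le>r. A $ k * B $ (n - k)))
      - ((\<Sum>k\<le>r. (A - 1) $ k * B $ (n - k)) - (\<Sum>s\<le>r. (1 - B - (1 - B)\<^sup>2) $ s * a (n - s))))
      \<in> O(\<lambda>n. a (n - Suc r))"
    by (rule sum_in_bigo(2)[OF iffD2[OF landau_o.big.uminus_in_iff ends] low])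
  ultimately show ?case
    unfolding expansion_upto_def by (subst landau_o.big.in_cong)
qed

text \<open>The power rule, by iterating the Leibniz rule; domination is assumed for every power
  because each one becomes a factor. For \<open>m = 0\<close> the truncated exponent
  \<open>m - 1\<close> is harmless, as \<open>of_nat m\<close> vanishes.\<close>

lemma expansion_power:
  assumes a: "gargantuan a" and inv: "Abs_fps a * (1 - B) = 1" and B0: "B $ 0 = 0"
    and B: "\<And>m k. \<bar>(B ^ m) $ k\<bar> \<le> \<bar>a k\<bar>"
  shows "expansion_upto a (B ^ m) (of_nat m * B ^ (m - 1) * (1 - B)\<^sup>2) r"
proof (induction m arbitrary: r)
  case 0
  have "(\<lambda>n. (1::real fps) $ n) \<in> O(\<lambda>n. a (n - Suc r))"
    by (rule bigoI[of _ 0]) (auto intro: eventually_sequentiallyI[of 1])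
  then show ?case by (simp add: expansion_upto_def)
next
  case (Suc m)
  have "expansion_upto a (B * B ^ m)
      (B * (of_nat m * B ^ (m - 1) * (1 - B)\<^sup>2) + B ^ m * (1 - B)\<^sup>2) r"
    using B[of 1] B
    by (intro expansion_mult a expansion_of_inverse inv B0 Suc.IH) auto
  moreover have "B * (of_nat m * B ^ (m - 1) * (1 - B)\<^sup>2) + B ^ m * (1 - B)\<^sup>2 =
      of_nat (Suc m) * B ^ (Suc m - 1) * (1 - B)\<^sup>2"
    by (cases m) (simp_all add: algebra_simps)
  ultimately show ?case by simp
qed

section \<open>Counting sequences\<close>

lemma of_size_SEQ:
  "of_size (SEQ B) n = {xs. set xs \<subseteq> objects B \<and> sum_list (map (obj_size B) xs) = n}"
  by (auto simp: of_size_def SEQ_def class_power_def)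

lemma of_size_class_power: "of_size (class_power B m) n = {xs \<in> of_size (SEQ B) n. length xs = m}"
  by (auto simp: of_size_def SEQ_def class_power_def)

text \<open>The size \<open>k\<close> of the head separates the pieces of the union, and Cons is
  injective on each. The tails are left abstract as \<open>Q\<close> to serve both
  \<open>SEQ B\<close> and the powers of \<open>B\<close>.\<close>

lemma card_Cons_of_size:
  assumes "unlabeled_class B" "\<And>k. finite (Q k)"
  shows "card (\<Union>k\<le>n. (\<lambda>(x, xs). x # xs) ` (of_size B k \<times> Q (n - k))) =
         (\<Sum>k\<le>n. card (of_size B k) * card (Q (n - k)))"
proof -
  have "card (\<Union>k\<le>n. (\<lambda>(x, xs). x # xs) ` (of_size B k \<times> Q (n - k))) =
      (\<Sum>k\<le>n. card ((\<lambda>(x, xs). x # xs) ` (of_size B k \<times> Q (n - k))))"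
    using assms by (intro card_UN_disjoint) (auto simp: unlabeled_class_def of_size_def)
  also have "\<dots> = (\<Sum>k\<le>n. card (of_size B k \<times> Q (n - k)))"
    by (intro sum.cong refl card_image) (auto simp: inj_on_def)
  finally show ?thesis by (simp add: card_cartesian_product)
qed

lemma counting_SEQ:
  assumes "unlabeled_class B" "unlabeled_class (SEQ B)"
  shows "counting (SEQ B) n =
    (if n = 0 then 1 else 0) + (\<Sum>k\<le>n. counting B k * counting (SEQ B) (n - k))"
proof -
  let ?U = "\<Union>k\<le>n. (\<lambda>(x, xs). x # xs) ` (of_size B k \<times> of_size (SEQ B) (n - k))"
  \<comment> \<open>The empty list accounts for the 1 in A = 1 + B A, and splitting off the head for
    the product.\<close>
  have split: "of_size (SEQ B) n = (if n = 0 then {[]} else {}) \<union> ?U"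
  proof (intro set_eqI)
    fix xs show "xs \<in> of_size (SEQ B) n \<longleftrightarrow> xs \<in> (if n = 0 then {[]} else {}) \<union> ?U"
      by (cases xs) (auto simp: of_size_SEQ of_size_def[of B] image_iff)
  qed
  have fin: "finite ?U"
    using assms by (auto simp: unlabeled_class_def)
  have "card (of_size (SEQ B) n) = card (if n = 0 then {[] :: 'a list} else {}) + card ?U"
    by (subst split, rule card_Un_disjoint) (use fin in \<open>auto split: if_splits\<close>)
  moreover have "card ?U = (\<Sum>k\<le>n. card (of_size B k) * card (of_size (SEQ B) (n - k)))"
    using assms by (intro card_Cons_of_size) (auto simp: unlabeled_class_def)
  ultimately show ?thesis by (simp add: counting_def)
qed

lemma finite_of_size_class_power:
  assumes "unlabeled_class (SEQ B)"
  shows "finite (of_size (class_power B m) n)"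
  using assms by (auto simp: of_size_class_power unlabeled_class_def)

lemma counting_class_power_0: "counting (class_power B 0) n = (if n = 0 then 1 else 0)"
proof -
  have "of_size (class_power B 0) n = (if n = 0 then {[]} else {})"
    by (auto simp: of_size_class_power of_size_SEQ)
  then show ?thesis by (simp add: counting_def)
qed

lemma counting_class_power_Suc:
  assumes "unlabeled_class B" "unlabeled_class (SEQ B)"
  shows "counting (class_power B (Suc m)) n =
    (\<Sum>k\<le>n. counting B k * counting (class_power B m) (n - k))"
proof -
  have "of_size (class_power B (Suc m)) n =
      (\<Union>k\<le>n. (\<lambda>(x, xs). x # xs) ` (of_size B k \<times> of_size (class_power B m) (n - k)))"
  proof (intro set_eqI)
    fix xs show "xs \<in> of_size (class_power B (Suc m)) n \<longleftrightarrow>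
        xs \<in> (\<Union>k\<le>n. (\<lambda>(x, xs). x # xs) ` (of_size B k \<times> of_size (class_power B m) (n - k)))"
      by (cases xs) (auto simp: of_size_class_power of_size_SEQ of_size_def[of B] image_iff)
  qed
  then show ?thesis
    using card_Cons_of_size[of B "of_size (class_power B m)", OF assms(1)
        finite_of_size_class_power[OF assms(2)]]
    by (simp add: counting_def)
qed

lemma SEQ_fps:
  assumes "unlabeled_class B" "unlabeled_class (SEQ B)"
  shows "Abs_fps (counting (SEQ B)) * (1 - Abs_fps (counting B)) = 1"
proof -
  have "Abs_fps (counting (SEQ B)) = 1 + Abs_fps (counting B) * Abs_fps (counting (SEQ B))"
    by (rule fps_ext, subst fps_nth_Abs_fps, subst counting_SEQ[OF assms])
      (simp add: fps_mult_nth atLeast0AtMost)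
  then show ?thesis by (simp add: algebra_simps)
qed

lemma class_power_fps:
  assumes "unlabeled_class B" "unlabeled_class (SEQ B)"
  shows "Abs_fps (counting B) ^ m = Abs_fps (counting (class_power B m))"
proof (induction m)
  case 0
  show ?case by (rule fps_ext) (simp add: counting_class_power_0)
next
  case (Suc m)
  then show ?case
    by (intro fps_ext) (simp add: counting_class_power_Suc[OF assms] fps_mult_nth atLeast0AtMost)
qed

text \<open>Supplies the domination hypothesis of \<open>expansion_power\<close>.\<close>

lemma counting_class_power_le_SEQ:
  assumes "unlabeled_class (SEQ B)"
  shows "counting (class_power B m) n \<le> counting (SEQ B) n"
  using assms unfolding counting_def
  by (auto simp: of_size_class_power unlabeled_class_def intro!: card_mono)

lemma counting_class_power_1:
  assumes "unlabeled_class B" "unlabeled_class (SEQ B)"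
  shows "counting (class_power B (Suc 0)) = counting B"
  using class_power_fps[OF assms, of 1] by (simp add: fps_eq_iff fun_eq_iff)

lemma uniform_prob_SEQ_components:
  assumes "unlabeled_class (SEQ B)" "counting (SEQ B) n \<noteq> 0"
  shows "uniform_prob (SEQ B) n (has_SEQ_components B m) =
    counting (class_power B m) n / counting (SEQ B) n"
proof -
  have ne: "finite (of_size (SEQ B) n)" "of_size (SEQ B) n \<noteq> {}"
    using assms by (auto simp: unlabeled_class_def counting_def)
  have "of_size (SEQ B) n \<inter> {xs. has_SEQ_components B m xs} = of_size (class_power B m) n"
    by (auto simp: has_SEQ_components_def of_size_def SEQ_def class_power_def)
  with ne show ?thesis
    by (simp add: uniform_prob_def measure_pmf_of_set counting_def)
qed

section \<open>The number of components\<close>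

text \<open>The probability is the coefficient of \<open>?B ^ m\<close> divided by
  \<open>?a n\<close>, so the power rule is divided by \<open>?a n\<close>, which is eventually
  nonzero.\<close>

lemma asymp_expansion_SEQ_components:
  assumes un: "unlabeled_class B" "unlabeled_class (SEQ B)" and "counting B 0 = 0"
    and garg: "gargantuan_class (SEQ B)" and "m \<ge> 1"
  shows "asymp_expansion
    (\<lambda>n. uniform_prob (SEQ B) n (has_SEQ_components B m)) 0
    (\<lambda>k. real m * (counting (class_power B (m - 1)) k
                    - 2 * counting (class_power B m) k
                    + counting (class_power B (m + 1)) k))
    (\<lambda>k n. counting (SEQ B) (n - k) / counting (SEQ B) n)"
    (is "asymp_expansion ?p 0 ?c (\<lambda>k n. ?a (n - k) / ?a n)")
proof -
  have a: "gargantuan ?a" using garg by (simp add: gargantuan_class_def)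
  then have nz: "\<forall>\<^sub>F n in sequentially. ?a n \<noteq> 0" by (simp add: gargantuan_def)
  have div: "(\<lambda>n. f n / ?a n) \<in> O(\<lambda>n. g n / ?a n)" if "f \<in> O(g)" for f g :: "nat \<Rightarrow> real"
    using that nz by (intro landau_o.big.divide_right) auto
  let ?B = "Abs_fps (counting B)"
  \<comment> \<open>Here \<open>m \<ge> 1\<close> matters: it makes \<open>?B ^ (m - 1) * ?B\<close>
    equal to \<open>?B ^ m\<close>.\<close>
  have "of_nat m * ?B ^ (m - 1) * (1 - ?B)\<^sup>2 =
      of_nat m * (?B ^ (m - 1) - 2 * ?B ^ m + ?B ^ (m + 1))"
    using \<open>m \<ge> 1\<close> by (cases m) (simp_all add: algebra_simps power2_eq_square)
  then have coeff: "(of_nat m * ?B ^ (m - 1) * (1 - ?B)\<^sup>2) $ k = ?c k" for k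
    by (simp only: class_power_fps[OF un] flip: fps_of_nat)
      (simp add: numeral_fps_const)
  have bound: "\<bar>(?B ^ m) $ k\<bar> \<le> \<bar>?a k\<bar>" for m k
    using counting_class_power_le_SEQ[OF un(2), of m k]
    by (simp add: class_power_fps[OF un] counting_def)
  have "expansion_upto ?a (?B ^ m) (of_nat m * ?B ^ (m - 1) * (1 - ?B)\<^sup>2) r" for r
    using assms(3) by (intro expansion_power a SEQ_fps un bound) auto
  then have main: "(\<lambda>n. counting (class_power B m) n - (\<Sum>k\<le>r. ?c k * ?a (n - k)))
      \<in> O(\<lambda>n. ?a (n - Suc r))" for r
    unfolding expansion_upto_def coeff by (simp add: class_power_fps[OF un])
  have "(\<lambda>n. ?p n - (\<Sum>k=0..r. ?c k * (?a (n - k) / ?a n))) \<in> O(\<lambda>n. ?a (n - (r + 1)) / ?a n)" for r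
  proof -
    have "\<forall>\<^sub>F n in sequentially. ?p n - (\<Sum>k=0..r. ?c k * (?a (n - k) / ?a n)) =
        (counting (class_power B m) n - (\<Sum>k\<le>r. ?c k * ?a (n - k))) / ?a n"
      using nz
    proof eventually_elim
      case (elim n)
      then show ?case
        by (simp add: uniform_prob_SEQ_components[OF un(2)] diff_divide_distrib
            sum_divide_distrib atLeast0AtMost)
    qed
    then show ?thesis
      using div[OF main] by (subst landau_o.big.in_cong) auto
  qed
  moreover have "(\<lambda>n. ?a (n - (k + 1)) / ?a n) \<in> o(\<lambda>n. ?a (n - k) / ?a n)" for k
    using gargantuan_smallo_shift[OF a, of k] nz by (intro landau_o.small.divide_right) auto
  ultimately show ?thesis by (simp add: asymp_expansion_def)
qed

theorem theorem6p1:
  fixes A :: "'b list comb_class" and B :: "'b comb_class"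
  assumes "unlabeled_class A" and "unlabeled_class B"
    and "counting B 0 = 0"
    and "A = SEQ B"
    and "gargantuan_class A"
  shows "(\<forall>m\<ge>1. asymp_expansion
            (\<lambda>n. uniform_prob A n (has_SEQ_components B m))
            0
            (\<lambda>k. real m * (counting (class_power B (m - 1)) k
                            - 2 * counting (class_power B m) k
                            + counting (class_power B (m + 1)) k))
            (\<lambda>k n. counting A (n - k) / counting A n))
         \<and> asymp_expansion
            (\<lambda>n. uniform_prob A n (SEQ_irreducible B) - 1)
            1
            (\<lambda>k. - (2 * counting B k - counting (class_power B 2) k))
            (\<lambda>k n. counting A (n - k) / counting A n)"
proof -
  note un = assms(2) assms(1)[unfolded assms(4)]
  \<comment> \<open>\<open>?c\<close> is the coefficient for \<open>m = 1\<close>. It is 1 at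
    \<open>k = 0\<close> and agrees with \<open>?d\<close> from \<open>k = 1\<close> on, where the
    zeroth power has no objects.\<close>
  let ?c = "\<lambda>k. counting (class_power B 0) k - 2 * counting B k + counting (class_power B 2) k"
  let ?d = "\<lambda>k. - (2 * counting B k - counting (class_power B 2) k)"
  let ?f = "\<lambda>k n. counting A (n - k) / counting A n"
  have comp: "\<forall>m\<ge>1. asymp_expansion
      (\<lambda>n. uniform_prob A n (has_SEQ_components B m)) 0
      (\<lambda>k. real m * (counting (class_power B (m - 1)) k
                      - 2 * counting (class_power B m) k
                      + counting (class_power B (m + 1)) k)) ?f"
    using asymp_expansion_SEQ_components[OF un] assms by simp
  have irr: "SEQ_irreducible B = has_SEQ_components B 1"
    by (simp add: SEQ_irreducible_def fun_eq_iff)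
  have one: "asymp_expansion (\<lambda>n. uniform_prob A n (SEQ_irreducible B)) 0 ?c ?f"
    using comp[rule_format, of 1] by (simp add: irr counting_class_power_1[OF un] numeral_2_eq_2)
  have "counting (class_power B 2) 0 = 0"
    using counting_class_power_Suc[OF un, of 1 0] assms(3) by (simp add: numeral_2_eq_2)
  then have c0: "?c 0 = 1" using assms(3) by (simp add: counting_class_power_0)
  have c: "?c k = ?d k" if "k \<ge> 1" for k
    using that by (simp add: counting_class_power_0)
  have nz: "\<forall>\<^sub>F n in sequentially. counting A n \<noteq> 0"
    using assms(5) by (simp add: gargantuan_class_def gargantuan_def)
  have "(\<lambda>n. uniform_prob A n (SEQ_irreducible B) - 1 - (\<Sum>k=1..r. ?d k * ?f k n)) \<in> O(?f (r + 1))" for r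
  proof -
    have sums: "(\<Sum>k=0..r. ?c k * ?f k n) = ?f 0 n + (\<Sum>k=1..r. ?d k * ?f k n)" for n
    proof -
      have "(\<Sum>k=0..r. ?c k * ?f k n) = ?c 0 * ?f 0 n + (\<Sum>k=1..r. ?c k * ?f k n)"
        by (simp add: sum.atLeast_Suc_atMost)
      also have "(\<Sum>k=1..r. ?c k * ?f k n) = (\<Sum>k=1..r. ?d k * ?f k n)"
        by (intro sum.cong refl arg_cong2[of _ _ _ _ "(*)"] c) auto
      finally show ?thesis unfolding c0 by simp
    qed
    \<comment> \<open>Once \<open>counting A n\<close> is nonzero, \<open>?f 0 n = 1\<close>, so the
      term for \<open>k = 0\<close> is exactly the 1 subtracted from the probability.\<close>
    have "\<forall>\<^sub>F n in sequentially.
        uniform_prob A n (SEQ_irreducible B) - 1 - (\<Sum>k=1..r. ?d k * ?f k n) =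
        uniform_prob A n (SEQ_irreducible B) - (\<Sum>k=0..r. ?c k * ?f k n)"
      using nz unfolding sums by eventually_elim simp
    moreover have "(\<lambda>n. uniform_prob A n (SEQ_irreducible B) - (\<Sum>k=0..r. ?c k * ?f k n)) \<in> O(?f (r + 1))"
      using one unfolding asymp_expansion_def by blast
    ultimately show ?thesis by (subst landau_o.big.in_cong)
  qed
  moreover have "\<forall>k\<ge>1. ?f (k + 1) \<in> o(?f k)"
    using one unfolding asymp_expansion_def by blast
  ultimately show ?thesis using comp unfolding asymp_expansion_def by blast
qed

end
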